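(* For every set $\Gamma\subseteq\mathbf{PL}$ and every formula $\alpha\in\mathbf{PL}$: $\Gamma\Vdash\alpha$ if and only if $\mathsf{Kh}\Gamma\vDash\mathsf{Kh}\alpha$, where $\mathsf{Kh}\Gamma=\{\mathsf{Kh}\gamma\mid\gamma\in\Gamma\}$, $\Vdash$ is entailment in inquisitive (support) semantics, and $\vDash$ is entailment in the know-how semantics over pointed models.
   Context: Fix a countable set $\mathbf{P}$ of proposition letters. $\mathbf{PL}$ is the set of formulas $\alpha::=p\mid\bot\mid(\alpha\land\alpha)\mid(\alpha\lor\alpha)\mid(\alpha\to\alpha)$ with $p\in\mathbf{P}$. A model is $M=\langle W,V\rangle$ with $W$ a non-empty set (of worlds) and $V:W\to\wp(\mathbf{P})$. Inquisitive semantics. A state in $M$ is any subset $s\subseteq W$ (possibly empty). Support $M,s\Vdash\alpha$ is defined by: $M,s\Vdash p$ iff $p\in V(w)$ for all $w\in s$; $M,s\Vdash\bot$ iff $s=\varnothing$; $M,s\Vdash\alpha\land\beta$ iff $M,s\Vdash\alpha$ and $M,s\Vdash\beta$; $M,s\Vdash\alpha\lor\beta$ iff $M,s\Vdash\alpha$ or $M,s\Vdash\beta$; $M,s\Vdash\alpha\to\beta$ iff for all $t\subseteq s$, $M,t\Vdash\alpha$ implies $M,t\Vdash\beta$. $\Gamma\Vdash\alpha$ means: for every model $M$ and state $s$ in $M$, if $M,s\Vdash\gamma$ for all $\gamma\in\Gamma$ then $M,s\Vdash\alpha$. Know-how semantics. The resolution space $S(\alpha)$ is defined by: $S(p)=\{p\}$;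 $S(\bot)=\{\bot\}$; $S(\alpha\lor\beta)=(S(\alpha)\times\{0\})\cup(S(\beta)\times\{1\})$; $S(\alpha\land\beta)=S(\alpha)\times S(\beta)$; $S(\alpha\to\beta)=S(\beta)^{S(\alpha)}$ (all functions from $S(\alpha)$ to $S(\beta)$). For a world $w$ of $M$, the set of actual resolutions $R(w,\alpha)\subseteq S(\alpha)$ is: $R(w,\bot)=\varnothing$; $R(w,p)=\{p\}$ if $p\in V(w)$ and $\varnothing$ otherwise; $R(w,\alpha\lor\beta)=(R(w,\alpha)\times\{0\})\cup(R(w,\beta)\times\{1\})$; $R(w,\alpha\land\beta)=R(w,\alpha)\times R(w,\beta)$; $R(w,\alpha\to\beta)=\{f\in S(\beta)^{S(\alpha)}\mid f[R(w,\alpha)]\subseteq R(w,\beta)\}$. For $w\in W$: $M,w\vDash\mathsf{Kh}\alpha$ iff there is $x\in S(\alpha)$ such that $x\in R(v,\alpha)$ for all $v\in W$. $\mathsf{Kh}\Gamma\vDash\mathsf{Kh}\alpha$ means: for every model $M$ and world $w$ of $M$, if $M,w\vDash\mathsf{Kh}\gamma$ for all $\gamma\in\Gamma$ then $M,w\vDash\mathsf{Kh}\alpha$. *)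

theory Defs
  imports "HOL-Library.FSet" "HOL-Library.FuncSet" "HOL-Library.Countable"
begin

datatype 'p fm =
    Prop 'p
  | Falsum
  | Conj "'p fm" "'p fm"
  | Disj "'p fm" "'p fm"
  | Impl "'p fm" "'p fm"

record ('w, 'p) model =
  worlds :: "'w set"
  val :: "'w \<Rightarrow> 'p set"

definition is_model :: "('w, 'p) model \<Rightarrow> bool" where
  "is_model M \<longleftrightarrow> worlds M \<noteq> {}"


section \<open>Inquisitive semantics\<close>

primrec support :: "('w, 'p) model \<Rightarrow> 'w set \<Rightarrow> 'p fm \<Rightarrow> bool" where
  "support M s (Prop p) \<longleftrightarrow> (\<forall>w\<in>s. p \<in> val M w)"
| "support M s Falsum \<longleftrightarrow> s = {}"
| "support M s (Conj \<alpha> \<beta>) \<longleftrightarrow> support M s \<alpha> \<and> support M s \<beta>"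
| "support M s (Disj \<alpha> \<beta>) \<longleftrightarrow> support M s \<alpha> \<or> support M s \<beta>"
| "support M s (Impl \<alpha> \<beta>) \<longleftrightarrow> (\<forall>t. t \<subseteq> s \<longrightarrow> support M t \<alpha> \<longrightarrow> support M t \<beta>)"

text \<open>
  HOL cannot quantify over types inside a formula, so the type of worlds is an explicit
  parameter of both entailment relations; a model is carried by an arbitrary non-empty set of
  elements of that type.  At the type \<open>'p set\<close> each relation already quantifies over all models
  of all types, see \<open>inq_entails_all_types\<close> and \<open>kh_entails_all_types\<close> below.
\<close>

definition inq_entails :: "'w itself \<Rightarrow> 'p fm set \<Rightarrow> 'p fm \<Rightarrow> bool" where
  "inq_entails _ \<Gamma> \<alpha> \<longleftrightarrow>
     (\<forall>(M :: ('w, 'p) model) s. is_model M \<longrightarrow> s \<subseteq> worlds M \<longrightarrow>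
        (\<forall>\<gamma>\<in>\<Gamma>. support M s \<gamma>) \<longrightarrow> support M s \<alpha>)"


section \<open>Know-how semantics\<close>

text \<open>
  A single type housing the elements of all resolution spaces.  \<open>InL x\<close> and \<open>InR x\<close> stand for
  \<open>(x, 0)\<close> and \<open>(x, 1)\<close>; \<open>Fun g\<close> is a function given by its graph.  Finite graphs
  lose nothing, since every resolution space is finite (\<open>finite_resolutions\<close>,
  \<open>bij_betw_fun_space\<close>).
\<close>

datatype 'p res =
    Atom 'p
  | Bot
  | InL "'p res"
  | InR "'p res"
  | Tup "'p res" "'p res"
  | Fun "('p res \<times> 'p res) fset"

definition fun_space :: "'p res set \<Rightarrow> 'p res set \<Rightarrow> (('p res \<times> 'p res) fset) set" where
  "fun_space A B = {g. fset g \<subseteq> A \<times> B \<and> (\<forall>x\<in>A. \<exists>!y. (x, y) \<in> fset g)}"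

primrec resolutions :: "'p fm \<Rightarrow> 'p res set" where
  "resolutions (Prop p) = {Atom p}"
| "resolutions Falsum = {Bot}"
| "resolutions (Conj \<alpha> \<beta>) = {Tup x y | x y. x \<in> resolutions \<alpha> \<and> y \<in> resolutions \<beta>}"
| "resolutions (Disj \<alpha> \<beta>) = InL ` resolutions \<alpha> \<union> InR ` resolutions \<beta>"
| "resolutions (Impl \<alpha> \<beta>) = Fun ` fun_space (resolutions \<alpha>) (resolutions \<beta>)"

primrec actual :: "('w, 'p) model \<Rightarrow> 'w \<Rightarrow> 'p fm \<Rightarrow> 'p res set" where
  "actual M w (Prop p) = (if p \<in> val M w then {Atom p} else {})"
| "actual M w Falsum = {}"
| "actual M w (Conj \<alpha> \<beta>) = {Tup x y | x y. x \<in> actual M w \<alpha> \<and> y \<in> actual M w \<beta>}"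
| "actual M w (Disj \<alpha> \<beta>) = InL ` actual M w \<alpha> \<union> InR ` actual M w \<beta>"
| "actual M w (Impl \<alpha> \<beta>) =
     {Fun g | g. g \<in> fun_space (resolutions \<alpha>) (resolutions \<beta>) \<and>
                 fset g `` actual M w \<alpha> \<subseteq> actual M w \<beta>}"

datatype 'p kh_fm = Kh "'p fm"

primrec kh_sat :: "('w, 'p) model \<Rightarrow> 'w \<Rightarrow> 'p kh_fm \<Rightarrow> bool" where
  "kh_sat M w (Kh \<alpha>) \<longleftrightarrow> (\<exists>x\<in>resolutions \<alpha>. \<forall>v\<in>worlds M. x \<in> actual M v \<alpha>)"

definition kh_entails :: "'w itself \<Rightarrow> 'p kh_fm set \<Rightarrow> 'p kh_fm \<Rightarrow> bool" where
  "kh_entails _ \<Delta> \<phi> \<longleftrightarrow>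
     (\<forall>(M :: ('w, 'p) model) w. is_model M \<longrightarrow> w \<in> worlds M \<longrightarrow>
        (\<forall>\<delta>\<in>\<Delta>. kh_sat M w \<delta>) \<longrightarrow> kh_sat M w \<phi>)"


section \<open>Adequacy of the encodings\<close>

lemma bij_betw_fun_space:
  assumes "finite A"
  shows "bij_betw (\<lambda>f. Abs_fset ((\<lambda>x. (x, f x)) ` A)) (A \<rightarrow>\<^sub>E B) (fun_space A B)"
proof -
  have fs: "fset (Abs_fset ((\<lambda>x. (x, f x)) ` A)) = (\<lambda>x. (x, f x)) ` A" for f :: "'a res \<Rightarrow> 'a res"
    using assms by (simp add: Abs_fset_inverse)
  show ?thesis
  proof (rule bij_betw_imageI)
    show "inj_on (\<lambda>f. Abs_fset ((\<lambda>x. (x, f x)) ` A)) (A \<rightarrow>\<^sub>E B)"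
    proof (rule inj_onI)
      fix f g
      assume f: "f \<in> A \<rightarrow>\<^sub>E B" and g: "g \<in> A \<rightarrow>\<^sub>E B"
        and "Abs_fset ((\<lambda>x. (x, f x)) ` A) = Abs_fset ((\<lambda>x. (x, g x)) ` A)"
      then have "(\<lambda>x. (x, f x)) ` A = (\<lambda>x. (x, g x)) ` A"
        using fs by metis
      then have "f x = g x" if "x \<in> A" for x
        using that by blast
      then show "f = g" using f g by (rule PiE_ext[rotated 2])
    qed
    show "(\<lambda>f. Abs_fset ((\<lambda>x. (x, f x)) ` A)) ` (A \<rightarrow>\<^sub>E B) = fun_space A B"
    proof (intro equalityI subsetI)
      fix g assume "g \<in> (\<lambda>f. Abs_fset ((\<lambda>x. (x, f x)) ` A)) ` (A \<rightarrow>\<^sub>E B)"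
      then show "g \<in> fun_space A B"
        by (fastforce simp: fun_space_def fs image_iff)
    next
      fix g assume g: "g \<in> fun_space A B"
      define f where "f = restrict (\<lambda>x. THE y. (x, y) \<in> fset g) A"
      have f: "(x, f x) \<in> fset g" if "x \<in> A" for x
        using g that theI'[of "\<lambda>y. (x, y) \<in> fset g"] by (auto simp: fun_space_def f_def)
      have "fset g = (\<lambda>x. (x, f x)) ` A"
      proof (intro equalityI subsetI)
        fix z assume z: "z \<in> fset g"
        obtain x y where xy: "z = (x, y)" by (cases z)
        have "x \<in> A" using g z xy by (auto simp: fun_space_def)
        moreover have "y = f x"
          using g z f[OF \<open>x \<in> A\<close>] \<open>x \<in> A\<close> unfolding xy fun_space_def by blast
        ultimately show "z \<in> (\<lambda>x. (x, f x)) ` A" using xy by blast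
      qed (use f in auto)
      then have "g = Abs_fset ((\<lambda>x. (x, f x)) ` A)"
        by (metis fset_inverse)
      moreover have "f \<in> A \<rightarrow>\<^sub>E B"
      proof (rule PiE_I)
        fix x assume "x \<in> A"
        then show "f x \<in> B" using f g unfolding fun_space_def by blast
      qed (simp add: f_def)
      ultimately show "g \<in> (\<lambda>f. Abs_fset ((\<lambda>x. (x, f x)) ` A)) ` (A \<rightarrow>\<^sub>E B)" by blast
    qed
  qed
qed

lemma finite_resolutions: "finite (resolutions \<alpha>)"
proof (induction \<alpha>)
  case (Conj \<alpha> \<beta>)
  then show ?case by (simp add: finite_image_set2)
next
  case (Impl \<alpha> \<beta>)
  then have "finite (fun_space (resolutions \<alpha>) (resolutions \<beta>))"
    using bij_betw_finite[OF bij_betw_fun_space] finite_PiE by metis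
  then show ?case by simp
qed simp_all

lemma actual_subset_resolutions: "actual M w \<alpha> \<subseteq> resolutions \<alpha>"
  by (induction \<alpha>) auto

lemma support_image:
  "support \<lparr>worlds = val M ` worlds M, val = id\<rparr> (val M ` s) \<alpha> \<longleftrightarrow> support M s \<alpha>"
  by (induction \<alpha> arbitrary: s) (auto simp: all_subset_image)

theorem inq_entails_all_types:
  fixes \<Gamma> :: "'p fm set"
  assumes "inq_entails TYPE('p set) \<Gamma> \<alpha>"
  shows "inq_entails TYPE('w) \<Gamma> \<alpha>"
  unfolding inq_entails_def
proof (intro allI impI)
  fix M :: "('w, 'p) model" and s
  assume "is_model M" "s \<subseteq> worlds M" "\<forall>\<gamma>\<in>\<Gamma>. support M s \<gamma>"
  then show "support M s \<alpha>"
    using assms[unfolded inq_entails_def, rule_format,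
        of "\<lparr>worlds = val M ` worlds M, val = id\<rparr>" "val M ` s"]
    by (simp add: support_image is_model_def image_mono)
qed

lemma actual_image:
  "actual \<lparr>worlds = val M ` worlds M, val = id\<rparr> (val M w) \<alpha> = actual M w \<alpha>"
  by (induction \<alpha>) auto

lemma kh_sat_image:
  "kh_sat \<lparr>worlds = val M ` worlds M, val = id\<rparr> (val M w) \<phi> \<longleftrightarrow> kh_sat M w \<phi>"
  by (cases \<phi>) (simp add: actual_image)

theorem kh_entails_all_types:
  fixes \<Delta> :: "'p kh_fm set"
  assumes "kh_entails TYPE('p set) \<Delta> \<phi>"
  shows "kh_entails TYPE('w) \<Delta> \<phi>"
  unfolding kh_entails_def
proof (intro allI impI)
  fix M :: "('w, 'p) model" and w
  assume "is_model M" "w \<in> worlds M" "\<forall>\<delta>\<in>\<Delta>. kh_sat M w \<delta>"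
  then show "kh_sat M w \<phi>"
    using assms[unfolded kh_entails_def, rule_format,
        of "\<lparr>worlds = val M ` worlds M, val = id\<rparr>" "val M w"]
    by (simp add: kh_sat_image is_model_def)
qed

end

theory Submission
  imports Defs
begin

text \<open>
  A state supports \<open>\<alpha>\<close> iff a single resolution of \<open>\<alpha>\<close> is actual at all of its worlds.  For an
  implication supported by \<open>s\<close>, each resolution \<open>x\<close> of the antecedent is common to the substate of
  worlds where it is actual; that substate supports the antecedent, hence the consequent, and a
  common resolution of the consequent there serves as the value at \<open>x\<close>.  Thus \<open>Kh \<alpha>\<close> says that the
  state of all worlds supports \<open>\<alpha>\<close>, and restricting a model to a non-empty state matches the two
  entailments; the empty state supports everything.
\<close>

lemma support_empty: "support M {} \<alpha>"
  by (induction \<alpha>) auto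

text \<open>Packages a choice of values as a finite graph; finiteness of \<open>A\<close> is what
  makes \<open>Abs_fset\<close> faithful.\<close>

lemma fun_space_choice:
  assumes "finite A" "\<And>x. x \<in> A \<Longrightarrow> f x \<in> B"
  obtains g where "g \<in> fun_space A B" "fset g = (\<lambda>x. (x, f x)) ` A"
proof
  let ?g = "Abs_fset ((\<lambda>x. (x, f x)) ` A)"
  show "fset ?g = (\<lambda>x. (x, f x)) ` A"
    using assms(1) by (simp add: Abs_fset_inverse)
  then show "?g \<in> fun_space A B"
    using assms(2) by (auto simp: fun_space_def)
qed

lemma support_iff_common_resolution:
  "support M s \<alpha> \<longleftrightarrow> (\<exists>x\<in>resolutions \<alpha>. \<forall>v\<in>s. x \<in> actual M v \<alpha>)"
\<comment> \<open>The state varies because the implication case applies both hypotheses to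
  substates.\<close>
proof (induction \<alpha> arbitrary: s)
  case (Conj \<alpha> \<beta>)
  have bex: "(\<exists>z\<in>resolutions (Conj \<alpha> \<beta>). P z) \<longleftrightarrow>
      (\<exists>x\<in>resolutions \<alpha>. \<exists>y\<in>resolutions \<beta>. P (Tup x y))" for P
    unfolding resolutions.simps by blast
  have act: "Tup x y \<in> actual M v (Conj \<alpha> \<beta>) \<longleftrightarrow> x \<in> actual M v \<alpha> \<and> y \<in> actual M v \<beta>"
    for x y v
    by simp
  show ?case unfolding support.simps Conj.IH bex act by blast
next
  case (Disj \<alpha> \<beta>)
  show ?case by (simp add: Disj.IH bex_Un image_iff)
next
  case (Impl \<alpha> \<beta>)
  show ?case
  proof
    assume s: "support M s (Impl \<alpha> \<beta>)"
    have "\<exists>y\<in>resolutions \<beta>. \<forall>v\<in>{v\<in>s. x \<in> actual M v \<alpha>}. y \<in> actual M v \<beta>"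
      if "x \<in> resolutions \<alpha>" for x
    proof -
      have "support M {v\<in>s. x \<in> actual M v \<alpha>} \<alpha>"
        using Impl.IH(1) that by blast
      then have "support M {v\<in>s. x \<in> actual M v \<alpha>} \<beta>"
        using s by simp
      then show ?thesis using Impl.IH(2) by blast
    qed
    then have "\<forall>x\<in>resolutions \<alpha>. \<exists>y. y \<in> resolutions \<beta> \<and>
        (\<forall>v\<in>{v\<in>s. x \<in> actual M v \<alpha>}. y \<in> actual M v \<beta>)"
      by blast
    from bchoice[OF this] obtain f where f: "\<And>x. x \<in> resolutions \<alpha> \<Longrightarrow> f x \<in> resolutions \<beta>"
      "\<And>x v. \<lbrakk>x \<in> resolutions \<alpha>; v \<in> s; x \<in> actual M v \<alpha>\<rbrakk> \<Longrightarrow> f x \<in> actual M v \<beta>"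
      by blast
    obtain g where "g \<in> fun_space (resolutions \<alpha>) (resolutions \<beta>)"
      "fset g = (\<lambda>x. (x, f x)) ` resolutions \<alpha>"
      using f(1) by (rule fun_space_choice[where f = f, OF finite_resolutions])
    \<comment> \<open>The witness is \<open>Fun g\<close>: each pair in \<open>g\<close> is
      \<open>(x, f x)\<close> with \<open>x\<close> in \<open>resolutions \<alpha>\<close>, so
      \<open>f(2)\<close> applies.\<close>
    then show "\<exists>x\<in>resolutions (Impl \<alpha> \<beta>). \<forall>v\<in>s. x \<in> actual M v (Impl \<alpha> \<beta>)"
      using f(2) by (intro bexI[of _ "Fun g"]) auto
  next
    assume "\<exists>x\<in>resolutions (Impl \<alpha> \<beta>). \<forall>v\<in>s. x \<in> actual M v (Impl \<alpha> \<beta>)"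
    then obtain g where g: "g \<in> fun_space (resolutions \<alpha>) (resolutions \<beta>)"
      "\<And>v. v \<in> s \<Longrightarrow> fset g `` actual M v \<alpha> \<subseteq> actual M v \<beta>"
      by auto
    have "support M t \<beta>" if t: "t \<subseteq> s" "support M t \<alpha>" for t
    proof -
      obtain x where x: "x \<in> resolutions \<alpha>" "\<forall>v\<in>t. x \<in> actual M v \<alpha>"
        using t(2) Impl.IH(1) by blast
      \<comment> \<open>As \<open>x\<close> is actual throughout \<open>t\<close>, its value
        \<open>y\<close> under \<open>g\<close> is too.\<close>
      then obtain y where "(x, y) \<in> fset g" "y \<in> resolutions \<beta>"
        using g(1) unfolding fun_space_def by blast
      then show ?thesis using x g(2) t(1) Impl.IH(2) by blast
    qed
    then show "support M s (Impl \<alpha> \<beta>)" by simp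
  qed
qed auto

lemma kh_sat_iff_support: "kh_sat M w (Kh \<alpha>) \<longleftrightarrow> support M (worlds M) \<alpha>"
  by (simp add: support_iff_common_resolution)

text \<open>Support consults only the valuation and the state, so a state can become the domain of a
  smaller model.\<close>

lemma support_worlds_update: "support (M\<lparr>worlds := W\<rparr>) s \<alpha> \<longleftrightarrow> support M s \<alpha>"
  by (induction \<alpha> arbitrary: s) auto

theorem theorem35:
  fixes \<Gamma> :: "('p::countable) fm set" and \<alpha> :: "'p fm"
  shows "inq_entails TYPE('w) \<Gamma> \<alpha> \<longleftrightarrow> kh_entails TYPE('w) (Kh ` \<Gamma>) (Kh \<alpha>)"
proof
  assume "inq_entails TYPE('w) \<Gamma> \<alpha>"
  \<comment> \<open>Support entailment is applied to the state of all worlds.\<close>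
  then show "kh_entails TYPE('w) (Kh ` \<Gamma>) (Kh \<alpha>)"
    unfolding inq_entails_def kh_entails_def by (simp add: kh_sat_iff_support del: kh_sat.simps)
next
  assume kh: "kh_entails TYPE('w) (Kh ` \<Gamma>) (Kh \<alpha>)"
  show "inq_entails TYPE('w) \<Gamma> \<alpha>"
    unfolding inq_entails_def
  proof (intro allI impI)
    fix M :: "('w, 'p) model" and s
    assume \<Gamma>: "\<forall>\<gamma>\<in>\<Gamma>. support M s \<gamma>"
    show "support M s \<alpha>"
    \<comment> \<open>An empty state cannot be the domain of a model, so it is treated
      apart.\<close>
    proof (cases "s = {}")
      case True
      then show ?thesis by (simp add: support_empty)
    next
      case False
      then obtain w where "w \<in> s" by blast
      have "\<forall>\<delta>\<in>Kh ` \<Gamma>. kh_sat (M\<lparr>worlds := s\<rparr>) w \<delta>"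
        using \<Gamma> by (simp add: kh_sat_iff_support support_worlds_update del: kh_sat.simps)
      then have "kh_sat (M\<lparr>worlds := s\<rparr>) w (Kh \<alpha>)"
        using kh[unfolded kh_entails_def] \<open>w \<in> s\<close> False by (simp add: is_model_def del: kh_sat.simps)
      then show ?thesis
        by (simp add: kh_sat_iff_support support_worlds_update del: kh_sat.simps)
    qed
  qed
qed

end
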